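(* Let $\chi,\mu$ be probability measures on $\mathbb{R}$, $\ddot\mu$ a symmetrization of $\mu$, and $\mathfrak{D}(\cdot,m)$ the associated deconvolution function. Assume that there exists $\tau>0$ with $$\int_0^\tau \frac{1-\Phi_{\ddot\mu}(t)}{t}\,dt < \infty,$$ and that there exists $T>0$ with $$\int_T^\infty \frac{|\Phi_\chi(t)|}{t}\,dt < \infty.$$ Then the limit $\lim_{m\to\infty}\|\mathfrak{D}(\cdot,m) - F_\chi\|_\infty$ exists and lies in $[0,\infty)$. The limit equals zero if $\mathcal{N}_\mu\setminus\mathcal{N}_\chi$ has zero Lebesgue measure.
   Context: Measures are finite signed Borel measures on $\mathbb{R}$. $F_\nu(\xi) := \nu((-\infty,\xi])$, $\Phi_\nu(t) := \int e^{itx}\,\nu(dx)$, and $\mathcal{N}_\nu := \{t \in \mathbb{R}\cup\{\pm\infty\} : \Phi_\nu(t)=0\}$, where $\pm\infty \in \mathcal{N}_\nu$ means $\lim_{t\to\pm\infty}\Phi_\nu(t)=0$. $\nu^{*0}:=\delta_{\{0\}}$, $\nu^{*k} := \nu * \nu^{*(k-1)}$, and $F_\nu^{*k}$ is the distribution function of $\nu^{*k}$. A symmetrization of $\mu$ is a probability measure $\ddot\mu = \mu*\eta$, with $\eta$ a probability measure, such that $F_{\ddot\mu}(\xi-)=1-F_{\ddot\mu}(-\xi)$ for all $\xi$, $\Phi_{\ddot\mu}=\Phi_\mu\Phi_\eta$ is even with $0\le\Phi_{\ddot\mu}\le1$, and $\mathcal{N}_{\ddot\mu}=\mathcal{N}_\mu$.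 Put $\pi_{\ddot\mu} := \delta_{\{0\}} - \ddot\mu$, $\mathfrak{K}_{\ddot\mu}(\xi,m) := \sum_{\ell=0}^m F_{\pi_{\ddot\mu}}^{*\ell}(\xi)$. The deconvolution function is $\mathfrak{D}(\xi,m) := \int_{\mathbb{R}} F_{\chi*\ddot\mu}(\xi-x)\,\mathfrak{K}_{\ddot\mu}(dx,m)$, for $(\xi,m)\in\mathbb{R}\times\mathbb{N}_0$. $\|\cdot\|_\infty$ is the supremum norm on $\mathbb{R}$. *)

theory Defs
  imports "HOL-Probability.Probability"
begin

section \<open>Finite signed Borel measures on the real line\<close>

text \<open>
  A finite signed Borel measure is a countably additive set function \<open>real set \<Rightarrow> real\<close>, extended by
  0 to non-Borel sets.  The total function \<open>measure M\<close> has the same convention, so a finite Borel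
  measure \<open>M\<close> is the signed measure \<open>measure M\<close>.
\<close>

definition finite_signed_measure :: "(real set \<Rightarrow> real) \<Rightarrow> bool" where
  "finite_signed_measure \<nu> \<longleftrightarrow>
     (\<forall>A. A \<notin> sets borel \<longrightarrow> \<nu> A = 0) \<and>
     (\<forall>A :: nat \<Rightarrow> real set. range A \<subseteq> sets borel \<longrightarrow> disjoint_family A \<longrightarrow>
        (\<lambda>i. \<nu> (A i)) sums \<nu> (\<Union>i. A i))"

definition decomposes :: "(real set \<Rightarrow> real) \<Rightarrow> real measure \<Rightarrow> real measure \<Rightarrow> bool" where
  "decomposes \<nu> P N \<longleftrightarrow>
     finite_borel_measure P \<and> finite_borel_measure N \<and> (\<forall>A. \<nu> A = measure P A - measure N A)"

text \<open>
  The integral against \<open>\<nu>\<close> is \<open>\<integral>f dP - \<integral>f dN\<close> for a decomposition \<open>\<nu> = P - N\<close> into finite positive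
  measures, for instance the Jordan decomposition.  The value does not depend on the decomposition
  (see \<open>signed_integral_eq\<close> below).
\<close>

definition signed_integral :: "(real set \<Rightarrow> real) \<Rightarrow> (real \<Rightarrow> real) \<Rightarrow> real" where
  "signed_integral \<nu> f = (THE I. \<exists>P N. decomposes \<nu> P N \<and> integrable P f \<and> integrable N f \<and>
     I = integral\<^sup>L P f - integral\<^sup>L N f)"

definition signed_cdf :: "(real set \<Rightarrow> real) \<Rightarrow> real \<Rightarrow> real" where
  "signed_cdf \<nu> \<xi> = \<nu> {..\<xi>}"

definition signed_conv :: "(real set \<Rightarrow> real) \<Rightarrow> (real set \<Rightarrow> real) \<Rightarrow> real set \<Rightarrow> real" where
  "signed_conv \<nu> \<rho> A = signed_integral \<rho> (\<lambda>y. \<nu> {x. x + y \<in> A})"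

definition dirac0 :: "real set \<Rightarrow> real" where
  "dirac0 = measure (return borel 0)"

primrec conv_power :: "(real set \<Rightarrow> real) \<Rightarrow> nat \<Rightarrow> real set \<Rightarrow> real" where
  "conv_power \<nu> 0 = dirac0"
| "conv_power \<nu> (Suc k) = signed_conv \<nu> (conv_power \<nu> k)"

text \<open>
  The Lebesgue--Stieltjes integral \<open>\<integral>f(x) G(dx)\<close>, where \<open>G\<close> is the distribution function of a finite
  signed measure.  That measure is unique (see \<open>signed_cdf_unique\<close> below).
\<close>

definition stieltjes_integral :: "(real \<Rightarrow> real) \<Rightarrow> (real \<Rightarrow> real) \<Rightarrow> real" where
  "stieltjes_integral G f =
     signed_integral (THE \<nu>. finite_signed_measure \<nu> \<and> signed_cdf \<nu> = G) f"

lemma decomposes_nn_integral: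
  assumes D: "decomposes \<nu> P N" "decomposes \<nu> P' N'"
    and f: "f \<in> borel_measurable borel"
  shows "integral\<^sup>N P f + integral\<^sup>N N' f = integral\<^sup>N P' f + integral\<^sup>N N f"
proof -
  interpret P: finite_borel_measure P using D by (simp add: decomposes_def)
  interpret N: finite_borel_measure N using D by (simp add: decomposes_def)
  interpret P': finite_borel_measure P' using D by (simp add: decomposes_def)
  interpret N': finite_borel_measure N' using D by (simp add: decomposes_def)
  note [measurable_cong, simp] = P.M_is_borel N.M_is_borel P'.M_is_borel N'.M_is_borel
  show ?thesis using f
  proof (induction rule: borel_measurable_induct)
    case (cong f g)
    then show ?case by (simp cong: nn_integral_cong)
  next
    case (set A)
    have "measure P A + measure N' A = measure P' A + measure N A"
      using D by (simp add: decomposes_def) (metis add.commute diff_add_eq diff_eq_eq)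
    with set show ?case
      by (simp add: P.emeasure_eq_measure N.emeasure_eq_measure P'.emeasure_eq_measure
          N'.emeasure_eq_measure flip: ennreal_plus)
  next
    case (mult u c)
    then show ?case
      by (simp add: nn_integral_cmult flip: distrib_left)
  next
    case (add u v)
    then show ?case
      by (simp add: nn_integral_add) (metis (no_types, lifting) add.assoc add.left_commute)
  next
    case (seq U)
    have U: "U i \<in> borel_measurable P" "U i \<in> borel_measurable N"
      "U i \<in> borel_measurable P'" "U i \<in> borel_measurable N'" for i
      using seq(1)[of i] by measurable
    have inc: "incseq (\<lambda>i. integral\<^sup>N M (U i))" for M
      using seq by (auto intro!: nn_integral_mono simp: incseq_def le_fun_def)
    have "(SUP i. integral\<^sup>N P (U i)) + (SUP i. integral\<^sup>N N' (U i)) =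
       (SUP i. integral\<^sup>N P (U i) + integral\<^sup>N N' (U i))"
      by (intro ennreal_SUP_add[symmetric] inc)
    also have "\<dots> = (SUP i. integral\<^sup>N P' (U i) + integral\<^sup>N N (U i))"
      using seq by simp
    also have "\<dots> = (SUP i. integral\<^sup>N P' (U i)) + (SUP i. integral\<^sup>N N (U i))"
      by (intro ennreal_SUP_add inc)
    finally show ?case
      using U seq by (simp add: nn_integral_monotone_convergence_SUP image_comp)
  qed
qed

lemma decomposes_integral:
  fixes f :: "real \<Rightarrow> real"
  assumes D: "decomposes \<nu> P N" "decomposes \<nu> P' N'"
    and f: "integrable P f" "integrable N f" "integrable P' f" "integrable N' f"
  shows "integral\<^sup>L P f - integral\<^sup>L N f = integral\<^sup>L P' f - integral\<^sup>L N' f"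
proof -
  have "sets P = sets borel"
    using D by (simp add: decomposes_def finite_borel_measure.M_is_borel)
  with f(1) have fm: "f \<in> borel_measurable borel"
    using borel_measurable_integrable measurable_cong_sets by blast
  have *: "enn2real (\<integral>\<^sup>+x. ennreal (g x) \<partial>P) + enn2real (\<integral>\<^sup>+x. ennreal (g x) \<partial>N') =
        enn2real (\<integral>\<^sup>+x. ennreal (g x) \<partial>P') + enn2real (\<integral>\<^sup>+x. ennreal (g x) \<partial>N)"
    if g: "g \<in> borel_measurable borel" "integrable P g" "integrable N g" "integrable P' g" "integrable N' g" for g :: "real \<Rightarrow> real"
  proof -
    have fin: "(\<integral>\<^sup>+x. ennreal (g x) \<partial>M) < top" if "integrable M g" for M
      using that real_integrable_def[of M g] by (simp add: less_top)
    show ?thesis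
      using decomposes_nn_integral[OF D, of "\<lambda>x. ennreal (g x)"] g fin
      by (simp flip: enn2real_plus)
  qed
  have "(\<lambda>x. - f x) \<in> borel_measurable borel" using fm by simp
  from *[OF this] *[OF fm] f show ?thesis
    by (simp add: real_lebesgue_integral_def)
qed

lemma signed_integral_eq:
  assumes "decomposes \<nu> P N" "integrable P f" "integrable N f"
  shows "signed_integral \<nu> f = integral\<^sup>L P f - integral\<^sup>L N f"
  unfolding signed_integral_def
  using assms by (intro the_equality) (blast, metis decomposes_integral)

lemma signed_cdf_unique:
  assumes \<nu>: "finite_signed_measure \<nu>" and \<rho>: "finite_signed_measure \<rho>"
    and eq: "signed_cdf \<nu> = signed_cdf \<rho>"
  shows "\<nu> = \<rho>"
proof
  fix A :: "real set"
  have sums: "(\<lambda>i. m (A i)) sums m (\<Union>i. A i)"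
    if "finite_signed_measure m" "range A \<subseteq> sets borel" "disjoint_family A"
    for m and A :: "nat \<Rightarrow> real set"
    using that by (simp add: finite_signed_measure_def)
  have empty: "m {} = 0" if m: "finite_signed_measure m" for m
  proof -
    have "(\<lambda>i::nat. m {}) sums m {}"
      using sums[OF m, of "\<lambda>_. {}"] by (simp add: disjoint_family_on_def)
    then show ?thesis
      using summable_const_iff sums_summable by blast
  qed
  have union: "m (A \<union> B) = m A + m B"
    if m: "finite_signed_measure m" and "A \<in> sets borel" "B \<in> sets borel" "A \<inter> B = {}" for m A B
  proof -
    have "range (binaryset A B) \<subseteq> sets borel" "disjoint_family (binaryset A B)"
      using that by (auto simp: range_binaryset_eq disjoint_family_on_def binaryset_def)
    from sums[OF m this] have "(\<lambda>i. m (binaryset A B i)) sums m (A \<union> B)"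
      by (simp only: UN_binaryset_eq)
    moreover have "(\<lambda>i. m (binaryset A B i)) sums (m A + m B)"
      using binaryset_sums[of m A B] empty[OF m] by simp
    ultimately show ?thesis by (rule sums_unique2)
  qed
  have UNIV: "(\<lambda>n. m {..real n}) \<longlonglongrightarrow> m UNIV" if m: "finite_signed_measure m" for m
  proof -
    define D where "D = disjointed (\<lambda>n. {..real n})"
    have sub: "\<Union> (D ` {..<Suc n}) = {..real n}" for n
    proof -
      have "\<Union> (D ` {..<Suc n}) = (\<Union>i<Suc n. {..real i})"
        unfolding D_def lessThan_atLeast0 by (rule finite_UN_disjointed_eq)
      also have "\<dots> = {..real n}"
      proof
        show "(\<Union>i<Suc n. {..real i}) \<subseteq> {..real n}"
          by (auto simp: less_Suc_eq_le intro: order_trans)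
        show "{..real n} \<subseteq> (\<Union>i<Suc n. {..real i})"
          by (rule UN_upper) simp
      qed
      finally show ?thesis .
    qed
    have D: "range D \<subseteq> sets borel" "disjoint_family D"
      unfolding D_def
      by (rule sets.range_disjointed_sets, simp add: image_subset_iff)
        (rule disjoint_family_disjointed)
    have fin: "(\<Sum>i<n. m (D i)) = m (\<Union> (D ` {..<n}))" for n
    proof (induction n)
      case (Suc n)
      have "D i \<inter> D n = {}" if "i < n" for i
        using disjoint_family_onD[OF D(2), of i n] that by simp
      then have "\<Union> (D ` {..<n}) \<inter> D n = {}" by blast
      moreover have "D i \<in> sets borel" for i using D(1) by blast
      then have "\<Union> (D ` {..<n}) \<in> sets borel" "D n \<in> sets borel" by blast+
      ultimately have "m (\<Union> (D ` {..<n}) \<union> D n) = m (\<Union> (D ` {..<n})) + m (D n)"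
        by (intro union[OF m])
      then show ?case using Suc by (simp add: lessThan_Suc Un_commute)
    qed (simp add: empty[OF m])
    have "(\<Union>i. D i) = UNIV"
      unfolding D_def UN_disjointed_eq using real_arch_simple by auto
    then have "(\<lambda>n. \<Sum>i<n. m (D i)) \<longlonglongrightarrow> m UNIV"
      using sums[OF m D] by (simp add: sums_def)
    then have "(\<lambda>n. \<Sum>i<Suc n. m (D i)) \<longlonglongrightarrow> m UNIV"
      by (rule LIMSEQ_Suc)
    then show ?thesis by (simp only: fin sub)
  qed
  have cdf: "\<nu> {..x} = \<rho> {..x}" for x
    using fun_cong[OF eq, of x] by (simp add: signed_cdf_def)
  have eq_UNIV: "\<nu> UNIV = \<rho> UNIV"
    using UNIV[OF \<nu>] UNIV[OF \<rho>] unfolding cdf by (rule LIMSEQ_unique)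
  have borel: "sets borel = sigma_sets UNIV (range (\<lambda>a::real. {..a}))"
    by (simp add: borel_eq_atMost[where 'a=real])
  show "\<nu> A = \<rho> A"
  proof (cases "A \<in> sets borel")
    case True
    have "Int_stable (range (\<lambda>a::real. {..a}))"
      by (auto simp: Int_stable_def)
    moreover have "range (\<lambda>a::real. {..a}) \<subseteq> Pow UNIV" by simp
    moreover have "A \<in> sigma_sets UNIV (range (\<lambda>a::real. {..a}))"
      using True borel by simp
    ultimately show ?thesis
    proof (induction rule: sigma_sets_induct_disjoint)
      case (compl A)
      then have "A \<in> sets borel" by (simp only: borel)
      then have "A \<in> sets borel" "UNIV - A \<in> sets borel" by auto
      then have "m (A \<union> (UNIV - A)) = m A + m (UNIV - A)" if "finite_signed_measure m" for m
        using union[OF that, of A "UNIV - A"] by blast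
      from this[OF \<nu>] this[OF \<rho>] show ?case
        using compl(2) eq_UNIV by (simp only: Un_Diff_cancel Un_UNIV_right)
    next
      case (union A)
      then have "range A \<subseteq> sets borel" by (simp only: borel)
      from sums[OF \<nu> this union(1)] sums[OF \<rho> this union(1)] show ?case
        by (simp only: union(3) sums_iff)
    qed (auto simp: cdf empty[OF \<nu>] empty[OF \<rho>])
  qed (use \<nu> \<rho> in \<open>simp add: finite_signed_measure_def\<close>)
qed

section \<open>Zeros of characteristic functions and symmetrizations\<close>

definition char_zeros :: "real measure \<Rightarrow> ereal set" where
  "char_zeros M =
     {ereal t | t. char M t = 0} \<union>
     {t. t = \<infinity> \<and> (char M \<longlongrightarrow> 0) at_top} \<union>
     {t. t = -\<infinity> \<and> (char M \<longlongrightarrow> 0) at_bot}"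

definition symmetrization :: "real measure \<Rightarrow> real measure \<Rightarrow> bool" where
  "symmetrization \<mu> \<mu>' \<longleftrightarrow>
     real_distribution \<mu>' \<and>
     (\<exists>\<eta>. real_distribution \<eta> \<and> \<mu>' = (\<mu> \<star> \<eta>) \<and>
          (\<forall>t. char \<mu>' t = char \<mu> t * char \<eta> t)) \<and>
     (\<forall>\<xi>. (cdf \<mu>' \<longlongrightarrow> 1 - cdf \<mu>' (-\<xi>)) (at_left \<xi>)) \<and>
     (\<forall>t. char \<mu>' (-t) = char \<mu>' t) \<and>
     (\<forall>t. char \<mu>' t \<in> \<real> \<and> 0 \<le> Re (char \<mu>' t) \<and> Re (char \<mu>' t) \<le> 1) \<and>
     char_zeros \<mu>' = char_zeros \<mu>"

section \<open>The deconvolution function\<close>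

text \<open>In this section \<open>\<mu>'\<close> stands for the symmetrization of \<open>\<mu>\<close>.\<close>

definition deconv_pi :: "real measure \<Rightarrow> real set \<Rightarrow> real" where
  "deconv_pi \<mu>' A = dirac0 A - measure \<mu>' A"

definition deconv_kernel :: "real measure \<Rightarrow> real \<Rightarrow> nat \<Rightarrow> real" where
  "deconv_kernel \<mu>' \<xi> m = (\<Sum>l=0..m. signed_cdf (conv_power (deconv_pi \<mu>') l) \<xi>)"

definition deconv_fun :: "real measure \<Rightarrow> real measure \<Rightarrow> real \<Rightarrow> nat \<Rightarrow> real" where
  "deconv_fun chi \<mu>' \<xi> m =
     stieltjes_integral (\<lambda>x. deconv_kernel \<mu>' x m) (\<lambda>x. cdf (chi \<star> \<mu>') (\<xi> - x))"

text \<open>The supremum norm is taken in \<^typ>\<open>ennreal\<close>, so that it is \<open>\<infinity>\<close> on unbounded functions.\<close>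

definition sup_norm :: "(real \<Rightarrow> real) \<Rightarrow> ennreal" where
  "sup_norm g = (SUP x. ennreal \<bar>g x\<bar>)"

end

theory Submission
  imports Defs
begin

text \<open>
  Write \<open>\<phi>\<close> for the characteristic function of the symmetrization \<open>\<mu>'\<close>, so that \<open>0 \<le> \<phi> \<le> 1\<close>, and
  \<open>I\<^sub>l f\<close> for the integral of \<open>f\<close> against the \<open>l\<close>-th convolution power of \<open>\<delta>\<^sub>0 - \<mu>'\<close>.  With
  \<open>(S f) y = \<integral> f (x + y) \<mu>'(dx)\<close> the convolution powers satisfy \<open>I\<^sub>l\<^sub>+\<^sub>1 f = I\<^sub>l (f - S f)\<close>.

  For \<open>h x = cdf chi (\<xi> - x)\<close> the integrand of the deconvolution function is \<open>S h\<close>, because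
  convolving \<open>chi\<close> with \<open>\<mu>'\<close> averages the translates of its distribution function.  Hence
  the deconvolution function is \<open>\<Sum>l\<le>m. I\<^sub>l (S h) = \<Sum>l\<le>m. I\<^sub>l h - I\<^sub>l\<^sub>+\<^sub>1 h\<close>, which telescopes to
  \<open>cdf chi \<xi> - I\<^sub>m (h - S h)\<close> (lemma \<open>deconv_fun_eq\<close>).

  The error term is computed on the Fourier side.  The two integrability assumptions ensure that
  \<open>char chi t * (1 - \<phi> t) / t\<close> is integrable, near the origin and at infinity respectively.  For such
  a pair of measures Levy's inversion formula turns \<open>cdf chi - cdf (chi \<star> \<mu>')\<close>, that is \<open>h - S h\<close>,
  into an absolutely convergent Fourier integral (\<open>cdf_diff_eq_fourier\<close>).  On Fourier integrals
  \<open>S\<close> acts by multiplying the integrand with \<open>\<phi>\<close>, so \<open>I\<^sub>m\<close> multiplies it with \<open>(1 - \<phi>)\<^sup>m\<close>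
  (\<open>signed_integral_conv_power_fourier\<close>).

  As \<open>m\<close> grows, \<open>(1 - \<phi>)\<^sup>m\<close> decreases to the indicator of the zeros of \<open>\<phi>\<close>.  By dominated convergence
  the integrands converge in \<open>L\<^sup>1\<close>, so the errors converge uniformly to a bounded function, and their
  supremum norms converge to the norm of that function.  Its integrand lives on the zeros of \<open>\<phi>\<close>, which
  are the zeros of the characteristic function of \<open>\<mu>\<close>, and contains \<open>char chi\<close> as a factor.  It therefore
  vanishes almost everywhere if almost every zero for \<open>\<mu>\<close> is one for \<open>chi\<close>.
\<close>

section \<open>Integration against finite signed measures\<close>

lemma finite_borel_measure_integrable:
  fixes f :: "real \<Rightarrow> 'b::{banach, second_countable_topology}"
  assumes "finite_borel_measure M" "f \<in> borel_measurable borel" "bounded (range f)"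
  shows "integrable M f"
proof -
  interpret finite_borel_measure M by fact
  obtain B where "\<And>x. norm (f x) \<le> B" using assms(3) by (auto simp: bounded_iff)
  then show ?thesis
    using assms(2) by (intro integrable_const_bound[of _ B]) (auto simp: measurable_cong_sets[OF M_is_borel refl])
qed

lemma finite_borel_measure_integral_bounded:
  fixes f :: "real \<Rightarrow> real \<Rightarrow> 'b::{banach, second_countable_topology}"
  assumes "finite_borel_measure M" "case_prod f \<in> borel_measurable borel"
    and B: "\<And>x y. norm (f x y) \<le> B"
  shows "(\<lambda>y. \<integral>x. f y x \<partial>M) \<in> borel_measurable borel" "bounded (range (\<lambda>y. \<integral>x. f y x \<partial>M))"
proof -
  interpret finite_borel_measure M by fact
  note M_is_borel[measurable_cong]
  have [measurable]: "case_prod f \<in> borel_measurable (borel \<Otimes>\<^sub>M borel)"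
    using assms(2) by (simp only: borel_prod)
  show "(\<lambda>y. \<integral>x. f y x \<partial>M) \<in> borel_measurable borel"
    by measurable
  have "norm (\<integral>x. f y x \<partial>M) \<le> B * measure M (space M)" for y
  proof -
    have "norm (\<integral>x. f y x \<partial>M) \<le> (\<integral>x. norm (f y x) \<partial>M)" by simp
    also have "\<dots> \<le> (\<integral>x. B \<partial>M)"
      using B by (intro integral_mono) (auto intro!: integrable_const_bound[of _ B])
    finally show ?thesis by (simp add: mult.commute)
  qed
  then show "bounded (range (\<lambda>y. \<integral>x. f y x \<partial>M))"
    by (auto simp: bounded_iff)
qed

text \<open>
  The convolution powers of \<open>\<delta>\<^sub>0 - \<mu>'\<close> are signed, and their positive and negative parts are built
  recursively by adding measures.
\<close>

definition sum_measure :: "real measure \<Rightarrow> real measure \<Rightarrow> real measure" where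
  "sum_measure M N = measure_of UNIV (sets borel) (\<lambda>A. emeasure M A + emeasure N A)"

lemma
  assumes "finite_borel_measure M" "finite_borel_measure N"
  shows finite_borel_measure_sum_measure: "finite_borel_measure (sum_measure M N)"
    and measure_sum_measure: "measure (sum_measure M N) A = measure M A + measure N A"
proof -
  interpret M: finite_borel_measure M by fact
  interpret N: finite_borel_measure N by fact
  have sets: "sets (sum_measure M N) = sets borel"
    unfolding sum_measure_def by (metis sets.sets_measure_of_eq space_borel)
  have em: "emeasure (sum_measure M N) A = emeasure M A + emeasure N A" if A: "A \<in> sets borel" for A
  proof (rule emeasure_measure_of[OF sum_measure_def])
    show "positive (sets (sum_measure M N)) (\<lambda>A. emeasure M A + emeasure N A)"
      by (simp add: positive_def)
    show "countably_additive (sets (sum_measure M N)) (\<lambda>A. emeasure M A + emeasure N A)"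
      by (auto simp: countably_additive_def sets M.M_is_borel N.M_is_borel suminf_emeasure
          simp flip: suminf_add)
  qed (use A sets in \<open>auto simp: M.borel_UNIV\<close>)
  have fin: "emeasure (sum_measure M N) A \<noteq> \<infinity>" for A
    using em[of A] by (cases "A \<in> sets borel") (auto simp: emeasure_notin_sets sets)
  show "finite_borel_measure (sum_measure M N)"
    by (auto simp: finite_borel_measure_def finite_borel_measure_axioms_def sets intro!: finite_measureI fin)
  show "measure (sum_measure M N) A = measure M A + measure N A"
  proof (cases "A \<in> sets borel")
    case True
    then show ?thesis
      unfolding measure_def em[OF True] by (subst enn2real_plus) (auto simp: less_top[symmetric])
  next
    case False
    then show ?thesis by (simp add: measure_notin_sets sets M.M_is_borel N.M_is_borel)
  qed
qed

lemma finite_borel_measure_null_measure: "finite_borel_measure (null_measure borel)"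
  by (auto simp: finite_borel_measure_def finite_borel_measure_axioms_def intro!: finite_measureI)

lemma decomposes_positive: "finite_borel_measure M \<Longrightarrow> decomposes (measure M) M (null_measure borel)"
  by (simp add: decomposes_def finite_borel_measure_null_measure measure_def)

lemma decomposes_add:
  assumes "decomposes \<nu> P N" "decomposes \<rho> P' N'"
  shows "decomposes (\<lambda>A. \<nu> A + \<rho> A) (sum_measure P P') (sum_measure N N')"
  using assms by (auto simp: decomposes_def measure_sum_measure finite_borel_measure_sum_measure)

text \<open>
  Both \<open>M + N - M\<close> and \<open>N - 0\<close> decompose \<open>N\<close>, and the integral against a signed measure does not
  depend on the decomposition.
\<close>

lemma integral_sum_measure:
  fixes f :: "real \<Rightarrow> real"
  assumes M: "finite_borel_measure M" and N: "finite_borel_measure N"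
    and f: "f \<in> borel_measurable borel" "bounded (range f)"
  shows "integral\<^sup>L (sum_measure M N) f = integral\<^sup>L M f + integral\<^sup>L N f"
proof -
  note D = decomposes_positive[OF finite_borel_measure_sum_measure[OF M N]]
  have D': "decomposes (measure N) (sum_measure M N) M"
    using M N by (simp add: decomposes_def measure_sum_measure finite_borel_measure_sum_measure)
  note int = finite_borel_measure_integrable[OF _ f]
  have "integral\<^sup>L (sum_measure M N) f - integral\<^sup>L M f
      = integral\<^sup>L N f - integral\<^sup>L (null_measure borel) f"
    by (rule decomposes_integral[OF D' decomposes_positive[OF N]])
      (auto intro!: int M N f finite_borel_measure_sum_measure finite_borel_measure_null_measure)
  then show ?thesis by (simp add: integral_null_measure)
qed

text \<open>
  The signed measures that are differences of two finite positive ones.  Their closure under sums and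
  under convolution with a probability measure provides explicit decompositions for all measures
  below.
\<close>

definition has_decomposition :: "(real set \<Rightarrow> real) \<Rightarrow> bool" where
  "has_decomposition \<nu> \<longleftrightarrow> (\<exists>P N. decomposes \<nu> P N)"

lemma has_decompositionE:
  assumes "has_decomposition \<nu>"
  obtains P N where "decomposes \<nu> P N" "finite_borel_measure P" "finite_borel_measure N"
    "\<And>f. f \<in> borel_measurable borel \<Longrightarrow> bounded (range f)
       \<Longrightarrow> signed_integral \<nu> f = integral\<^sup>L P f - integral\<^sup>L N f"
proof -
  obtain P N where D: "decomposes \<nu> P N" using assms by (auto simp: has_decomposition_def)
  show ?thesis
    by (rule that[OF D]) (use D in \<open>auto simp: decomposes_def intro!: signed_integral_eq[OF D] finite_borel_measure_integrable\<close>)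
qed

lemma has_decomposition_add:
  assumes "has_decomposition \<nu>" "has_decomposition \<rho>"
  shows "has_decomposition (\<lambda>A. \<nu> A + \<rho> A)"
  using assms decomposes_add unfolding has_decomposition_def by blast

lemma has_decomposition_finite_signed_measure:
  assumes "has_decomposition \<nu>"
  shows "finite_signed_measure \<nu>"
proof -
  obtain P N where D: "decomposes \<nu> P N" "finite_borel_measure P" "finite_borel_measure N"
    using assms by (rule has_decompositionE)
  interpret P: finite_borel_measure P by fact
  interpret N: finite_borel_measure N by fact
  have \<nu>: "\<nu> = (\<lambda>A. measure P A - measure N A)" using D(1) by (auto simp: decomposes_def)
  show ?thesis
    unfolding finite_signed_measure_def \<nu>
    by (auto intro!: sums_diff P.finite_measure_UNION N.finite_measure_UNION
        simp: measure_notin_sets P.M_is_borel N.M_is_borel)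
qed

lemma signed_integral_add:
  assumes "has_decomposition \<nu>" "has_decomposition \<rho>"
    and f: "f \<in> borel_measurable borel" "bounded (range f)"
  shows "signed_integral (\<lambda>A. \<nu> A + \<rho> A) f = signed_integral \<nu> f + signed_integral \<rho> f"
proof -
  obtain P N where D: "decomposes \<nu> P N" "finite_borel_measure P" "finite_borel_measure N"
    "signed_integral \<nu> f = integral\<^sup>L P f - integral\<^sup>L N f"
    using assms(1) f by (metis has_decompositionE)
  obtain P' N' where D': "decomposes \<rho> P' N'" "finite_borel_measure P'" "finite_borel_measure N'"
    "signed_integral \<rho> f = integral\<^sup>L P' f - integral\<^sup>L N' f"
    using assms(2) f by (metis has_decompositionE)
  have "signed_integral (\<lambda>A. \<nu> A + \<rho> A) f
      = integral\<^sup>L (sum_measure P P') f - integral\<^sup>L (sum_measure N N') f"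
    using D D' f by (intro signed_integral_eq decomposes_add finite_borel_measure_integrable finite_borel_measure_sum_measure)
  then show ?thesis
    using D D' f by (simp add: integral_sum_measure)
qed

lemma signed_integral_diff:
  assumes "has_decomposition \<nu>"
    and "f \<in> borel_measurable borel" "bounded (range f)" "g \<in> borel_measurable borel" "bounded (range g)"
  shows "signed_integral \<nu> (\<lambda>x. f x - g x) = signed_integral \<nu> f - signed_integral \<nu> g"
proof -
  obtain P N where D: "decomposes \<nu> P N" "finite_borel_measure P" "finite_borel_measure N"
    using assms(1) by (rule has_decompositionE)
  note int = finite_borel_measure_integrable[OF D(2)] finite_borel_measure_integrable[OF D(3)]
  show ?thesis
    using assms by (simp add: signed_integral_eq[OF D(1)] int)
qed

lemma has_decomposition_dirac0: "has_decomposition dirac0"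
  and signed_integral_dirac0:
    "f \<in> borel_measurable borel \<Longrightarrow> bounded (range f) \<Longrightarrow> signed_integral dirac0 f = f 0"
proof -
  interpret prob_space "return borel (0::real)" by (rule prob_space_return) simp
  have fb: "finite_borel_measure (return borel (0::real))"
    by unfold_locales simp
  note D = decomposes_positive[OF fb, folded dirac0_def]
  show "has_decomposition dirac0" using D by (auto simp: has_decomposition_def)
  show "signed_integral dirac0 f = f 0" if "f \<in> borel_measurable borel" "bounded (range f)"
    using that fb
    by (simp add: signed_integral_eq[OF D] finite_borel_measure_integrable finite_borel_measure_null_measure
        integral_null_measure integral_return)
qed

section \<open>Convolution\<close>

lemma finite_borel_measure_convolution:
  assumes "finite_borel_measure M" "finite_borel_measure N"
  shows "finite_borel_measure (M \<star> N)"
  using assms by (auto simp: finite_borel_measure_def finite_borel_measure_axioms_def intro!: convolution_finite)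

lemma integral_convolution:
  fixes f :: "real \<Rightarrow> 'b::{banach, second_countable_topology}"
  assumes "finite_borel_measure M" "finite_borel_measure N"
    and f[measurable]: "f \<in> borel_measurable borel" and b: "bounded (range f)"
  shows "integral\<^sup>L (M \<star> N) f = (\<integral>x. \<integral>y. f (x + y) \<partial>N \<partial>M)"
proof -
  interpret M: finite_borel_measure M by fact
  interpret N: finite_borel_measure N by fact
  interpret pair_sigma_finite M N ..
  note M.M_is_borel[measurable_cong] N.M_is_borel[measurable_cong]
  obtain B where B: "\<And>x. norm (f x) \<le> B" using b by (auto simp: bounded_iff)
  interpret MN: finite_measure "M \<Otimes>\<^sub>M N"
    by (intro finite_measure_pair_measure) unfold_locales
  have "integrable (M \<Otimes>\<^sub>M N) (\<lambda>(x, y). f (x + y))"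
    using B by (intro MN.integrable_const_bound[of _ B]) auto
  from integral_fst'[OF this] show ?thesis
    unfolding convolution_def by (subst integral_distr) (auto simp: split_beta')
qed

lemma measure_convolution:
  assumes M: "finite_borel_measure M" and N: "finite_borel_measure N" and A: "A \<in> sets borel"
  shows "measure (M \<star> N) A = (\<integral>y. measure N {x. x + y \<in> A} \<partial>M)"
proof -
  interpret N: finite_borel_measure N by fact
  have A': "{x. x + y \<in> A} \<in> sets borel" for y
    using measurable_sets_borel[of "\<lambda>x. x + y" borel A] A by (simp add: vimage_def)
  have "measure (M \<star> N) A = integral\<^sup>L (M \<star> N) (indicat_real A)"
    using A by simp
  also have "\<dots> = (\<integral>y. \<integral>x. indicat_real A (y + x) \<partial>N \<partial>M)"
    using A by (intro integral_convolution M N) (auto simp: bounded_iff intro!: exI[of _ 1] split: split_indicator)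
  also have "\<dots> = (\<integral>y. measure N {x. x + y \<in> A} \<partial>M)"
  proof (intro Bochner_Integration.integral_cong refl)
    fix y
    have "(\<integral>x. indicat_real A (y + x) \<partial>N) = (\<integral>x. indicat_real {x. x + y \<in> A} x \<partial>N)"
      by (intro Bochner_Integration.integral_cong) (auto simp: add.commute split: split_indicator)
    then show "(\<integral>x. indicat_real A (y + x) \<partial>N) = measure N {x. x + y \<in> A}"
      using A' by (simp add: N.M_is_borel N.borel_UNIV)
  qed
  finally show ?thesis .
qed

text \<open>
  Signed measures vanish on non-Borel sets by convention; the equivalence shows that signed convolution
  respects that convention.
\<close>

lemma borel_translate_iff:
  fixes A :: "real set"
  shows "{x. x + y \<in> A} \<in> sets borel \<longleftrightarrow> A \<in> sets borel"
proof
  have tr: "{x. x + z \<in> B} \<in> sets borel" if "B \<in> sets borel" for B and z :: real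
    using measurable_sets_borel[of "\<lambda>x. x + z" borel B] that by (simp add: vimage_def)
  show "A \<in> sets borel" if "{x. x + y \<in> A} \<in> sets borel"
    using tr[OF that, of "-y"] by simp
  show "{x. x + y \<in> A} \<in> sets borel" if "A \<in> sets borel" using tr[OF that] .
qed

context
  fixes M :: "real measure"
  assumes M: "real_distribution M"
begin

interpretation M: real_distribution M by (fact M)

text \<open>
  This is \<open>(\<delta>\<^sub>0 - M) \<star> (P - N) = (P - N) + (N \<star> M - P \<star> M)\<close>, which exhibits the next
  convolution power as a difference of positive measures.
\<close>

lemma conv_power_deconv_pi_Suc:
  assumes D: "decomposes (conv_power (deconv_pi M) l) P N"
  shows "conv_power (deconv_pi M) (Suc l) A =
    conv_power (deconv_pi M) l A + (measure (N \<star> M) A - measure (P \<star> M) A)"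
proof -
  have P: "finite_borel_measure P" and N: "finite_borel_measure N"
    using D by (auto simp: decomposes_def)
  interpret P: finite_borel_measure P by fact
  interpret N: finite_borel_measure N by fact
  show ?thesis
  proof (cases "A \<in> sets borel")
    case A: True
    have eq: "(\<lambda>y. deconv_pi M {x. x + y \<in> A}) = (\<lambda>y. indicat_real A y - measure M {x. x + y \<in> A})"
      by (rule ext) (simp add: deconv_pi_def dirac0_def measure_return borel_translate_iff A indicator_def)
    have M': "measure M {x. x + y \<in> A} = (\<integral>x. indicat_real A (x + y) \<partial>M)" for y
    proof -
      have "(\<integral>x. indicat_real A (x + y) \<partial>M) = (\<integral>x. indicat_real {x. x + y \<in> A} x \<partial>M)"
        by (intro Bochner_Integration.integral_cong) (auto split: split_indicator)
      then show ?thesis by (simp add: borel_translate_iff A)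
    qed
    have g: "(\<lambda>y. measure M {x. x + y \<in> A}) \<in> borel_measurable borel"
      "bounded (range (\<lambda>y. measure M {x. x + y \<in> A}))"
      unfolding M' using A
      by (intro finite_borel_measure_integral_bounded[OF M.finite_borel_measure_M, where B=1];
          auto simp: split_indicator split_beta' simp flip: borel_prod)+
    have f: "indicat_real A \<in> borel_measurable borel" "bounded (range (indicat_real A))"
      using A by (auto simp: bounded_iff intro!: exI[of _ 1] split: split_indicator)
    have "has_decomposition (conv_power (deconv_pi M) l)"
      using D by (auto simp: has_decomposition_def)
    then have "conv_power (deconv_pi M) (Suc l) A =
        signed_integral (conv_power (deconv_pi M) l) (indicat_real A)
         - signed_integral (conv_power (deconv_pi M) l) (\<lambda>y. measure M {x. x + y \<in> A})"
      unfolding conv_power.simps signed_conv_def eq using f g by (intro signed_integral_diff)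
    also have "\<dots> = (measure P A - measure N A) - (measure (P \<star> M) A - measure (N \<star> M) A)"
      using A f g P N
      by (simp add: signed_integral_eq[OF D] finite_borel_measure_integrable
          measure_convolution M.finite_borel_measure_M P.borel_UNIV N.borel_UNIV)
    finally show ?thesis using D by (simp add: decomposes_def)
  next
    case A: False
    have "(\<lambda>y. deconv_pi M {x. x + y \<in> A}) = (\<lambda>y. 0)"
      by (rule ext) (simp add: deconv_pi_def dirac0_def borel_translate_iff A measure_notin_sets)
    then have "conv_power (deconv_pi M) (Suc l) A = 0"
      by (simp add: signed_conv_def signed_integral_eq[OF D])
    moreover have "conv_power (deconv_pi M) l A = 0"
      using D A by (simp add: decomposes_def P.M_is_borel N.M_is_borel measure_notin_sets)
    ultimately show ?thesis using A by (simp add: measure_notin_sets)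
  qed
qed

lemma decomposes_convolution_diff:
  assumes "finite_borel_measure P" "finite_borel_measure N"
  shows "decomposes (\<lambda>A. measure (N \<star> M) A - measure (P \<star> M) A) (N \<star> M) (P \<star> M)"
  using assms by (simp add: decomposes_def finite_borel_measure_convolution M.finite_borel_measure_M)

lemma has_decomposition_conv_power: "has_decomposition (conv_power (deconv_pi M) l)"
proof (induction l)
  case 0
  show ?case by (simp add: has_decomposition_dirac0)
next
  case (Suc l)
  then obtain P N where D: "decomposes (conv_power (deconv_pi M) l) P N"
    "finite_borel_measure P" "finite_borel_measure N"
    by (rule has_decompositionE)
  then show ?case
    using Suc unfolding ext[OF conv_power_deconv_pi_Suc[OF D(1)]]
    by (intro has_decomposition_add) (auto simp: has_decomposition_def intro: decomposes_convolution_diff)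
qed

text \<open>
  The adjoint form of the recursion: one convolution factor \<open>\<delta>\<^sub>0 - M\<close> is moved from the measure to the
  integrand.
\<close>

lemma signed_integral_conv_power_Suc:
  assumes f[measurable]: "f \<in> borel_measurable borel" and b: "bounded (range f)"
  shows "signed_integral (conv_power (deconv_pi M) (Suc l)) f =
    signed_integral (conv_power (deconv_pi M) l) (\<lambda>y. f y - (\<integral>x. f (x + y) \<partial>M))"
proof -
  obtain P N where D: "decomposes (conv_power (deconv_pi M) l) P N"
    "finite_borel_measure P" "finite_borel_measure N"
    using has_decomposition_conv_power by (rule has_decompositionE)
  note D' = decomposes_convolution_diff[OF D(2,3)]
  have conv: "integral\<^sup>L (Q \<star> M) f = (\<integral>y. \<integral>x. f (x + y) \<partial>M \<partial>Q)" if "finite_borel_measure Q" for Q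
    using integral_convolution[OF that M.finite_borel_measure_M f b] by (simp add: add.commute)
  obtain B where B: "\<And>x. norm (f x) \<le> B" using b by (auto simp: bounded_iff)
  have g: "(\<lambda>y. \<integral>x. f (x + y) \<partial>M) \<in> borel_measurable borel" "bounded (range (\<lambda>y. \<integral>x. f (x + y) \<partial>M))"
    by (intro finite_borel_measure_integral_bounded[OF M.finite_borel_measure_M, where B=B];
        auto simp: B[unfolded real_norm_def] simp flip: borel_prod)+
  have "signed_integral (conv_power (deconv_pi M) (Suc l)) f =
    signed_integral (conv_power (deconv_pi M) l) f
      + signed_integral (\<lambda>A. measure (N \<star> M) A - measure (P \<star> M) A) f"
    unfolding ext[OF conv_power_deconv_pi_Suc[OF D(1)]]
    using D' f b by (intro signed_integral_add has_decomposition_conv_power) (auto simp: has_decomposition_def)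
  also have "\<dots> = signed_integral (conv_power (deconv_pi M) l) (\<lambda>y. f y - (\<integral>x. f (x + y) \<partial>M))"
    using D(2,3) f b g
    by (simp add: signed_integral_eq[OF D(1)] signed_integral_eq[OF D'] conv
        finite_borel_measure_integrable finite_borel_measure_convolution M.finite_borel_measure_M)
  finally show ?thesis .
qed

end

lemma
  assumes "finite S" "\<And>l. l \<in> S \<Longrightarrow> has_decomposition (\<nu> l)"
  shows has_decomposition_sum: "has_decomposition (\<lambda>A. \<Sum>l\<in>S. \<nu> l A)"
    and signed_integral_sum: "f \<in> borel_measurable borel \<Longrightarrow> bounded (range f) \<Longrightarrow>
      signed_integral (\<lambda>A. \<Sum>l\<in>S. \<nu> l A) f = (\<Sum>l\<in>S. signed_integral (\<nu> l) f)"
proof -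
  have "has_decomposition (\<lambda>A. \<Sum>l\<in>S. \<nu> l A) \<and>
    (f \<in> borel_measurable borel \<longrightarrow> bounded (range f) \<longrightarrow>
      signed_integral (\<lambda>A. \<Sum>l\<in>S. \<nu> l A) f = (\<Sum>l\<in>S. signed_integral (\<nu> l) f))"
    using assms
  proof (induction S)
    case empty
    have "decomposes (\<lambda>A. 0) (null_measure borel) (null_measure borel)"
      by (simp add: decomposes_def finite_borel_measure_null_measure)
    then show ?case
      by (auto simp: has_decomposition_def signed_integral_eq finite_borel_measure_integrable
          finite_borel_measure_null_measure)
  next
    case (insert l S)
    then show ?case
      using has_decomposition_add[of "\<nu> l"] signed_integral_add[of "\<nu> l"] by auto
  qed
  then show "has_decomposition (\<lambda>A. \<Sum>l\<in>S. \<nu> l A)"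
    "f \<in> borel_measurable borel \<Longrightarrow> bounded (range f) \<Longrightarrow>
      signed_integral (\<lambda>A. \<Sum>l\<in>S. \<nu> l A) f = (\<Sum>l\<in>S. signed_integral (\<nu> l) f)"
    by blast+
qed

lemma stieltjes_integral_signed_cdf:
  assumes "has_decomposition \<nu>"
  shows "stieltjes_integral (signed_cdf \<nu>) f = signed_integral \<nu> f"
proof -
  have "(THE \<rho>. finite_signed_measure \<rho> \<and> signed_cdf \<rho> = signed_cdf \<nu>) = \<nu>"
    using has_decomposition_finite_signed_measure[OF assms] signed_cdf_unique
    by (intro the_equality) auto
  then show ?thesis by (simp add: stieltjes_integral_def)
qed

text \<open>
  The sum defining the kernel is a Neumann series for the inverse of convolution with \<open>M\<close>, so applying
  it to \<open>chi \<star> M\<close> telescopes and leaves \<open>chi\<close> up to one convolution power.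
\<close>

lemma deconv_fun_eq:
  assumes chi: "real_distribution chi" and M: "real_distribution M"
  shows "deconv_fun chi M \<xi> m = cdf chi \<xi>
    - signed_integral (conv_power (deconv_pi M) m) (\<lambda>x. cdf chi (\<xi> - x) - cdf (chi \<star> M) (\<xi> - x))"
proof -
  interpret chi: real_distribution chi by fact
  interpret M: real_distribution M by fact
  note fb = chi.finite_borel_measure_M M.finite_borel_measure_M
  let ?I = "\<lambda>l. signed_integral (conv_power (deconv_pi M) l)"
  let ?h = "\<lambda>x. cdf chi (\<xi> - x)" and ?Th = "\<lambda>x. cdf (chi \<star> M) (\<xi> - x)"
  have cdf_meas: "cdf Q \<in> borel_measurable borel" if "finite_borel_measure Q" for Q
    using that by (intro borel_measurable_mono monoI finite_borel_measure.cdf_nondecreasing)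
  have h: "(\<lambda>x. cdf Q (\<xi> - x)) \<in> borel_measurable borel" "bounded (range (\<lambda>x. cdf Q (\<xi> - x)))"
    if Q: "finite_borel_measure Q" for Q
  proof -
    show "(\<lambda>x. cdf Q (\<xi> - x)) \<in> borel_measurable borel"
      using measurable_compose[OF _ cdf_meas[OF Q], of "\<lambda>x. \<xi> - x" borel] by simp
    show "bounded (range (\<lambda>x. cdf Q (\<xi> - x)))"
      using finite_borel_measure.cdf_bounded[OF Q] finite_borel_measure.cdf_nonneg[OF Q]
      by (auto simp: bounded_iff abs_le_iff intro!: exI[of _ "measure Q (space Q)"])
        (metis neg_le_0_iff_le order_trans measure_nonneg)
  qed
  \<comment> \<open>Convolving with \<open>M\<close> averages the translates of the distribution function.\<close>
  have Th: "?Th y = (\<integral>x. ?h (x + y) \<partial>M)" for y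
  proof -
    have "?Th y = measure (M \<star> chi) {..\<xi> - y}"
      using convolution_commutative[of chi M] fb chi.M_is_borel M.M_is_borel
      by (simp add: cdf_def finite_borel_measure_def)
    also have "\<dots> = (\<integral>x. measure chi {z. z + x \<in> {..\<xi> - y}} \<partial>M)"
      by (intro measure_convolution fb) simp
    also have "\<dots> = (\<integral>x. ?h (x + y) \<partial>M)"
      unfolding cdf_def by (intro Bochner_Integration.integral_cong arg_cong2[where f=measure]) auto
    finally show ?thesis .
  qed
  note h1 = h[OF fb(1)] and h2 = h[OF finite_borel_measure_convolution[OF fb]]
  note dec = has_decomposition_conv_power[OF M]
  have diff: "?I l (\<lambda>x. ?h x - ?Th x) = ?I l ?h - ?I l ?Th" for l
    by (intro signed_integral_diff dec h1 h2)
  have step: "?I (Suc l) ?h = ?I l (\<lambda>x. ?h x - ?Th x)" for l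
    unfolding Th by (rule signed_integral_conv_power_Suc[OF M h1])
  have "(\<lambda>x. deconv_kernel M x m) = signed_cdf (\<lambda>A. \<Sum>l=0..m. conv_power (deconv_pi M) l A)"
    by (simp add: fun_eq_iff deconv_kernel_def signed_cdf_def)
  then have "deconv_fun chi M \<xi> m = (\<Sum>l=0..m. ?I l ?Th)"
    by (simp add: deconv_fun_def stieltjes_integral_signed_cdf has_decomposition_sum dec
        signed_integral_sum h2)
  also have "\<dots> = (\<Sum>l=0..m. ?I l ?h - ?I (Suc l) ?h)"
    by (simp add: step diff del: conv_power.simps)
  also have "\<dots> = ?I 0 ?h - ?I (Suc m) ?h"
    using sum_telescope[of "\<lambda>l. ?I l ?h" m] by (simp add: atLeast0AtMost)
  also have "?I 0 ?h = cdf chi \<xi>"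
    using signed_integral_dirac0[OF h1] by simp
  finally show ?thesis unfolding step .
qed

section \<open>Fourier integrals\<close>

definition fourier :: "(real \<Rightarrow> complex) \<Rightarrow> real \<Rightarrow> complex" where
  "fourier g x = (CLBINT t. iexp (-(t * x)) * g t)"

lemma integrable_iexp_mult [simp, intro]:
  fixes g :: "real \<Rightarrow> complex"
  assumes "integrable lborel g"
  shows "integrable lborel (\<lambda>t. iexp (t * x) * g t)" "integrable lborel (\<lambda>t. iexp (-(t * x)) * g t)"
proof -
  have "integrable lborel (\<lambda>t. iexp (c * t * x) * g t)" for c
    by (rule Bochner_Integration.integrable_bound[OF assms]) (use assms in \<open>auto simp: norm_mult\<close>)
  from this[of 1] this[of "-1"]
  show "integrable lborel (\<lambda>t. iexp (t * x) * g t)" "integrable lborel (\<lambda>t. iexp (-(t * x)) * g t)"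
    by simp_all
qed

lemma norm_fourier_le: "norm (fourier g x) \<le> (LBINT t. norm (g t))"
proof -
  have "norm (fourier g x) \<le> (LBINT t. norm (iexp (-(t * x)) * g t))"
    unfolding fourier_def by (rule integral_norm_bound)
  then show ?thesis by (simp add: norm_mult)
qed

lemma fourier_add:
  assumes "integrable lborel f" "integrable lborel g"
  shows "fourier (\<lambda>t. f t + g t) x = fourier f x + fourier g x"
  unfolding fourier_def distrib_left
  by (intro Bochner_Integration.integral_add integrable_iexp_mult assms)

lemma fourier_diff:
  assumes "integrable lborel f" "integrable lborel g"
  shows "fourier (\<lambda>t. f t - g t) x = fourier f x - fourier g x"
  unfolding fourier_def right_diff_distrib
  by (intro Bochner_Integration.integral_diff integrable_iexp_mult assms)

lemma fourier_cmult: "fourier (\<lambda>t. c * g t) x = c * fourier g x"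
  by (simp add: fourier_def mult.left_commute)

lemma fourier_shift: "fourier g (x - s) = fourier (\<lambda>t. iexp (t * s) * g t) x"
  unfolding fourier_def
  by (intro Bochner_Integration.integral_cong refl) (simp add: algebra_simps exp_diff exp_add exp_minus field_simps)

lemma continuous_fourier:
  assumes g: "integrable lborel g"
  shows "isCont (fourier g) x"
  unfolding continuous_at_sequentially comp_def fourier_def
proof safe
  fix X assume X: "X \<longlonglongrightarrow> x"
  show "(\<lambda>n. CLBINT t. iexp (-(t * X n)) * g t) \<longlonglongrightarrow> (CLBINT t. iexp (-(t * x)) * g t)"
  proof (rule integral_dominated_convergence[where w="\<lambda>t. norm (g t)"])
    show "AE t in lborel. (\<lambda>n. iexp (-(t * X n)) * g t) \<longlonglongrightarrow> iexp (-(t * x)) * g t"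
      by (intro AE_I2 tendsto_intros X)
  qed (use g in \<open>auto simp: norm_mult intro: borel_measurable_integrable\<close>)
qed

lemma borel_measurable_fourier [measurable]:
  "integrable lborel g \<Longrightarrow> fourier g \<in> borel_measurable borel"
  by (auto intro!: borel_measurable_continuous_onI continuous_at_imp_continuous_on continuous_fourier)

text \<open>
  The factor \<open>(1 + e\<^sup>i\<^sup>t) / 2\<close> is the Fourier multiplier of the average of a function and its translate
  by 1.  Off the null set \<open>2\<pi>\<int>\<close> its modulus is less than 1, so that its powers tend to 0.
\<close>

lemma norm_one_plus_iexp: "norm ((1 + iexp t) / 2) ^ 2 = (1 + cos t) / 2"
proof -
  have "norm ((1 + iexp t) / 2) ^ 2 = ((1 + cos t)\<^sup>2 + (sin t)\<^sup>2) / 4"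
    unfolding norm_divide power_divide cmod_power2 by (simp add: Re_exp Im_exp)
  also have "\<dots> = (1 + cos t) / 2"
    by (simp add: sin_squared_eq power2_sum field_simps)
  finally show ?thesis .
qed

lemma AE_norm_one_plus_iexp_less_one: "AE t in lborel. norm ((1 + iexp t) / 2) < 1"
proof (rule AE_I')
  have "{t. cos t = 1} = range (\<lambda>n::int. n * 2 * pi)"
    by (auto simp: cos_one_2pi_int)
  then have "countable {t. cos t = (1::real)}" by simp
  then show "{t. cos t = (1::real)} \<in> null_sets lborel"
    by (rule countable_imp_null_set_lborel)
  have "norm ((1 + iexp t) / 2) < 1" if "cos t \<noteq> 1" for t
  proof -
    have "norm ((1 + iexp t) / 2) ^ 2 < 1 ^ 2"
      unfolding norm_one_plus_iexp using that cos_le_one[of t] by (simp add: less_le)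
    then show ?thesis by (rule power_less_imp_less_base) simp
  qed
  then show "{t \<in> space lborel. \<not> norm ((1 + iexp t) / 2) < 1} \<subseteq> {t. cos t = 1}"
    by blast
qed

lemma norm_one_plus_iexp_le: "norm ((1 + iexp t) / 2) \<le> 1"
  using norm_triangle_ineq[of 1 "iexp t"] by (simp add: norm_divide)

text \<open>
  A weak form of the Riemann--Lebesgue lemma, in which the existence of the limit is assumed.  Averaging
  the function \<open>n\<close> times with its translate by 1 leaves its limit at \<open>-\<infinity>\<close> unchanged, but multiplies the
  integrand with the \<open>n\<close>-th power of \<open>(1 + e\<^sup>i\<^sup>t) / 2\<close>.  The limit is thus bounded by integrals that
  tend to 0.
\<close>

lemma fourier_limit_at_bot_eq_0:
  assumes g: "integrable lborel g" and L: "(fourier g \<longlongrightarrow> L) at_bot"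
  shows "L = 0"
proof -
  let ?w = "\<lambda>t. (1 + iexp t) / 2"
  have int: "integrable lborel (\<lambda>t. ?w t ^ n * g t)" for n
  proof (rule Bochner_Integration.integrable_bound[OF g])
    show "AE t in lborel. norm (?w t ^ n * g t) \<le> norm (g t)"
      using norm_one_plus_iexp_le by (auto simp: norm_mult norm_power intro!: mult_left_le_one_le power_le_one)
  qed (use g in measurable)
  have lim: "(fourier (\<lambda>t. ?w t ^ n * g t) \<longlongrightarrow> L) at_bot" for n
  proof (induction n)
    case 0
    then show ?case using L by simp
  next
    case (Suc n)
    let ?f = "\<lambda>t. ?w t ^ n * g t"
    have average: "fourier (\<lambda>t. ?w t ^ Suc n * g t) = (\<lambda>x. (fourier ?f x + fourier ?f (x - 1)) / 2)"
    proof
      fix x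
      have "(\<lambda>t. ?w t ^ Suc n * g t) = (\<lambda>t. 1/2 * (?f t + iexp (t * 1) * ?f t))"
        by (rule ext) (simp add: field_simps)
      then show "fourier (\<lambda>t. ?w t ^ Suc n * g t) x = (fourier ?f x + fourier ?f (x - 1)) / 2"
        by (simp only: fourier_cmult fourier_shift fourier_add[OF int integrable_iexp_mult(1)[OF int]]) simp
    qed
    have "((\<lambda>x. fourier ?f (x - 1)) \<longlongrightarrow> L) at_bot"
      by (rule filterlim_compose[OF Suc]) real_asymp
    from tendsto_divide[OF tendsto_add[OF Suc this] tendsto_const, of 2]
    show ?case unfolding average by simp
  qed
  have "norm L \<le> (LBINT t. norm (?w t ^ n * g t))" for n
    by (rule tendsto_upperbound[OF tendsto_norm[OF lim[of n]]]) (auto simp: norm_fourier_le)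
  moreover have "(\<lambda>n. LBINT t. norm (?w t ^ n * g t)) \<longlonglongrightarrow> (LBINT t::real. 0)"
  proof (rule integral_dominated_convergence[where w="\<lambda>t. norm (g t)"])
    show "AE t in lborel. (\<lambda>n. norm (?w t ^ n * g t)) \<longlonglongrightarrow> 0"
      using AE_norm_one_plus_iexp_less_one
    proof eventually_elim
      case (elim t)
      then show ?case
        using tendsto_mult_right[OF LIMSEQ_power_zero[of "norm (?w t)"], of "norm (g t)"]
        by (simp add: norm_mult norm_power)
    qed
    show "AE t in lborel. norm (norm (?w t ^ n * g t)) \<le> norm (g t)" for n
      using norm_one_plus_iexp_le by (auto simp: norm_mult norm_power intro!: mult_left_le_one_le power_le_one)
  qed (use g in \<open>auto intro: borel_measurable_integrable integrable_norm\<close>)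
  ultimately have "norm L \<le> 0"
    by (intro LIMSEQ_le_const[of _ 0]) auto
  then show ?thesis by simp
qed

section \<open>Inversion formula for the difference of two distribution functions\<close>

text \<open>
  Levy's inversion formula holds for a single measure in general only as a principal value.  The difference of the two
  characteristic functions is integrable after division by \<open>t\<close>, so for it the truncated integrals
  converge absolutely, and the contributions of the two end points separate.
\<close>

lemma cdf_diff_increment_fourier:
  assumes P: "real_distribution P" and Q: "real_distribution Q" and ab: "a \<le> b"
    and atoms: "measure P {a} = 0" "measure P {b} = 0" "measure Q {a} = 0" "measure Q {b} = 0"
    and int: "integrable lborel (\<lambda>t. (char P t - char Q t) / t)"
  defines "h \<equiv> fourier (\<lambda>t. \<i> / (2 * pi) * ((char P t - char Q t) / t))"
  shows "complex_of_real (cdf P b - cdf Q b) - h b = complex_of_real (cdf P a - cdf Q a) - h a"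
proof -
  interpret P: real_distribution P by fact
  interpret Q: real_distribution Q by fact
  let ?E = "\<lambda>t. (iexp (-(t * a)) - iexp (-(t * b))) / (\<i> * t)"
  have bound: "cmod (?E t) \<le> b - a" for t
  proof (cases "t = 0")
    case False
    then show ?thesis
      using Levy_Inversion_aux2[of "-b" "-a" t] ab by simp
  qed (use ab in simp)
  have interval: "(CLBINT t=-real n..real n. f t) = (CLBINT t. indicator {-real n<..<real n} t *\<^sub>R f t)" for f n
    by (simp add: interval_lebesgue_integral_def set_lebesgue_integral_def)
  have trunc: "integrable lborel (\<lambda>t. indicator {-real n<..<real n} t *\<^sub>R (?E t * char R t))"
    if R: "real_distribution R" for n R
  proof -
    interpret R: real_distribution R by fact
    have "norm (?E t * char R t) \<le> b - a" for t
      unfolding norm_mult using mult_mono[OF bound R.cmod_char_le_1] ab by simp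
    then show ?thesis
      by (intro integrableI_bounded_set_indicator[where B="b - a"]) auto
  qed
  have "(\<lambda>n. 1 / (2 * pi) * (CLBINT t=-real n..real n. ?E t * char P t)
           - 1 / (2 * pi) * (CLBINT t=-real n..real n. ?E t * char Q t))
     \<longlonglongrightarrow> complex_of_real (measure P {a<..b}) - complex_of_real (measure Q {a<..b})"
    by (intro tendsto_diff ab atoms
        P.Levy_Inversion[unfolded of_int_minus of_int_of_nat_eq]
        Q.Levy_Inversion[unfolded of_int_minus of_int_of_nat_eq])
  also have "(\<lambda>n. 1 / (2 * pi) * (CLBINT t=-real n..real n. ?E t * char P t)
           - 1 / (2 * pi) * (CLBINT t=-real n..real n. ?E t * char Q t))
     = (\<lambda>n. 1 / (2 * pi) * (CLBINT t. indicator {-real n<..<real n} t *\<^sub>R (?E t * (char P t - char Q t))))"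
    unfolding interval right_diff_distrib[symmetric]
    by (subst Bochner_Integration.integral_diff[symmetric, OF trunc[OF P] trunc[OF Q]])
      (simp add: right_diff_distrib scaleR_diff_right)
  finally have lim1: "(\<lambda>n. 1 / (2 * pi) * (CLBINT t. indicator {-real n<..<real n} t *\<^sub>R (?E t * (char P t - char Q t))))
     \<longlonglongrightarrow> complex_of_real (measure P {a<..b}) - complex_of_real (measure Q {a<..b})" .
  have w: "?E t * (char P t - char Q t) = - \<i> * (iexp (-(t * a)) * ((char P t - char Q t) / t))
      + \<i> * (iexp (-(t * b)) * ((char P t - char Q t) / t))" for t
    by (cases "t = 0") (simp_all add: field_simps)
  have intw: "integrable lborel (\<lambda>t. ?E t * (char P t - char Q t))"
    unfolding w by (intro Bochner_Integration.integrable_add integrable_mult_right integrable_iexp_mult int)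
  have "(\<lambda>n. CLBINT t. indicator {-real n<..<real n} t *\<^sub>R (?E t * (char P t - char Q t)))
     \<longlonglongrightarrow> (CLBINT t. ?E t * (char P t - char Q t))"
  proof (rule integral_dominated_convergence[where w="\<lambda>t. norm (?E t * (char P t - char Q t))"])
    show "AE t in lborel. (\<lambda>n. indicator {-real n<..<real n} t *\<^sub>R (?E t * (char P t - char Q t)))
       \<longlonglongrightarrow> ?E t * (char P t - char Q t)"
    proof (intro AE_I2 tendsto_eventually)
      fix t :: real
      obtain N :: nat where "\<bar>t\<bar> < N" using reals_Archimedean2 by blast
      then show "\<forall>\<^sub>F n in sequentially. indicator {-real n<..<real n} t *\<^sub>R (?E t * (char P t - char Q t))
          = ?E t * (char P t - char Q t)"
        by (intro eventually_sequentiallyI[of N]) (auto simp: indicator_def)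
    qed
  qed (use intw in \<open>auto simp: indicator_def\<close>)
  then have lim2: "(\<lambda>n. 1 / (2 * pi) * (CLBINT t. indicator {-real n<..<real n} t *\<^sub>R (?E t * (char P t - char Q t))))
     \<longlonglongrightarrow> 1 / (2 * pi) * (CLBINT t. ?E t * (char P t - char Q t))"
    by (intro tendsto_mult tendsto_const)
  have "(CLBINT t. ?E t * (char P t - char Q t)) = - \<i> * fourier (\<lambda>t. (char P t - char Q t) / t) a
      + \<i> * fourier (\<lambda>t. (char P t - char Q t) / t) b"
    unfolding w fourier_def integral_mult_right_zero[symmetric]
    by (intro Bochner_Integration.integral_add integrable_mult_right integrable_iexp_mult int)
  then have "1 / (2 * pi) * (CLBINT t. ?E t * (char P t - char Q t)) = h b - h a"
    unfolding h_def fourier_cmult by (simp add: field_simps)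
  with LIMSEQ_unique[OF lim1 lim2]
  have "complex_of_real (measure P {a<..b}) - complex_of_real (measure Q {a<..b}) = h b - h a"
    by simp
  moreover have "measure P {a<..b} = cdf P b - cdf P a" "measure Q {a<..b} = cdf Q b - cdf Q a"
    using ab P.cdf_diff_eq[of a b] Q.cdf_diff_eq[of a b] by (cases "a = b"; simp)+
  ultimately show ?thesis by (simp add: algebra_simps)
qed

text \<open>
  By the increment formula, the difference \<open>D\<close> of the two sides is constant away from the countably many
  atoms.  Right continuity extends this to all points, and the behaviour at \<open>-\<infinity>\<close> shows that the
  constant is 0: there the distribution functions vanish, and an integrable function has no other limit of
  its Fourier integral than 0.
\<close>

lemma cdf_diff_eq_fourier:
  assumes P: "real_distribution P" and Q: "real_distribution Q"
    and int: "integrable lborel (\<lambda>t. (char P t - char Q t) / t)"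
  shows "complex_of_real (cdf P x - cdf Q x) = fourier (\<lambda>t. \<i> / (2 * pi) * ((char P t - char Q t) / t)) x"
proof -
  interpret P: real_distribution P by fact
  interpret Q: real_distribution Q by fact
  let ?g = "\<lambda>t. \<i> / (2 * pi) * ((char P t - char Q t) / t)"
  have g: "integrable lborel ?g" using int by (rule integrable_mult_right)
  define A where "A = {x. measure P {x} \<noteq> 0} \<union> {x. measure Q {x} \<noteq> 0}"
  have A: "countable A"
    unfolding A_def using P.countable_support Q.countable_support by simp
  define D where "D = (\<lambda>x. complex_of_real (cdf P x - cdf Q x) - fourier ?g x)"
  have eqD: "D a = D b" if "a \<notin> A" "b \<notin> A" for a b
  proof (cases "a \<le> b")
    case True
    show ?thesis
      unfolding D_def using True that
      by (intro cdf_diff_increment_fourier[OF P Q _ _ _ _ _ int, symmetric]) (auto simp: A_def)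
  next
    case False
    then show ?thesis
      unfolding D_def using that
      by (intro cdf_diff_increment_fourier[OF P Q _ _ _ _ _ int]) (auto simp: A_def)
  qed
  have "\<exists>x. x \<notin> A"
    using A uncountable_UNIV_real by (metis UNIV_eq_I)
  then obtain x0 where x0: "x0 \<notin> A" by blast
  have const: "D x = D x0" for x
  proof (rule ccontr)
    assume ne: "D x \<noteq> D x0"
    have "(D \<longlongrightarrow> D x) (at_right x)"
      unfolding D_def of_real_diff
      using P.cdf_is_right_cont[of x] Q.cdf_is_right_cont[of x] continuous_fourier[OF g, of x]
      by (intro tendsto_intros) (auto simp: continuous_within intro: filterlim_at_split[THEN iffD1, THEN conjunct2] tendsto_within_subset)
    then have "\<forall>\<^sub>F y in at_right x. D y \<noteq> D x0"
      using ne by (rule tendsto_imp_eventually_ne)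
    then obtain b where b: "b > x" "\<And>y. x < y \<Longrightarrow> y < b \<Longrightarrow> D y \<noteq> D x0"
      by (auto simp: eventually_at_right[of x "x + 1"])
    \<comment> \<open>A right neighbourhood of \<open>x\<close> on which \<open>D\<close> avoids its generic value consists of atoms, but is uncountable.\<close>
    have "{x<..<b} \<subseteq> A"
      using b(2) eqD[OF _ x0] by (metis greaterThanLessThan_iff subsetI)
    with A have "countable {x<..<b}" by (rule countable_subset[rotated])
    with b(1) show False using uncountable_open_interval by blast
  qed
  have "(fourier ?g \<longlongrightarrow> - D x0) at_bot"
  proof -
    have "((\<lambda>x. complex_of_real (cdf P x - cdf Q x) - D x0) \<longlongrightarrow> complex_of_real (0 - 0) - D x0) at_bot"
      by (intro tendsto_intros P.cdf_lim_at_bot Q.cdf_lim_at_bot)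
    moreover have "complex_of_real (cdf P x - cdf Q x) - D x0 = fourier ?g x" for x
      unfolding const[of x, symmetric] by (simp add: D_def)
    ultimately show ?thesis by simp
  qed
  from fourier_limit_at_bot_eq_0[OF g this] have "D x0 = 0" by simp
  with const[of x] show ?thesis by (simp add: D_def)
qed

section \<open>Convolution powers acting on Fourier integrals\<close>

lemma char_convolution:
  assumes "real_distribution M" "real_distribution N"
  shows "char (M \<star> N) t = char M t * char N t"
proof -
  interpret M: real_distribution M by fact
  interpret N: real_distribution N by fact
  have "char (M \<star> N) t = (\<integral>x. \<integral>y. iexp (t * (x + y)) \<partial>N \<partial>M)"
    unfolding char_def
    by (intro integral_convolution M.finite_borel_measure_M N.finite_borel_measure_M)
      (auto simp: bounded_iff intro!: exI[of _ 1])
  also have "\<dots> = char M t * char N t"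
    by (simp add: char_def distrib_left exp_add)
  finally show ?thesis .
qed

lemma real_distribution_convolution:
  assumes "real_distribution M" "real_distribution N"
  shows "real_distribution (M \<star> N)"
proof -
  interpret M: real_distribution M by fact
  interpret N: real_distribution N by fact
  interpret prob_space "M \<Otimes>\<^sub>M N"
    by (intro prob_space_pair) unfold_locales
  show ?thesis unfolding convolution_def by (rule real_distribution_distr) simp
qed

lemma integral_fourier_translate:
  assumes M: "real_distribution M" and g: "integrable lborel g"
  shows "(\<integral>x. fourier g (\<xi> - x) \<partial>M) = fourier (\<lambda>t. char M t * g t) \<xi>"
proof -
  interpret M: real_distribution M by fact
  interpret pair_sigma_finite lborel M ..
  have [measurable]: "g \<in> borel_measurable borel" using g by auto
  have int: "integrable (lborel \<Otimes>\<^sub>M M) (\<lambda>(t, x). iexp (-(t * (\<xi> - x))) * g t)"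
  proof (rule Fubini_integrable)
    show "integrable lborel (\<lambda>t. \<integral>x. norm (case (t, x) of (t, x) \<Rightarrow> iexp (-(t * (\<xi> - x))) * g t) \<partial>M)"
      using g by (simp add: norm_mult M.prob_space[simplified])
    show "AE t in lborel. integrable M (\<lambda>x. case (t, x) of (t, x) \<Rightarrow> iexp (-(t * (\<xi> - x))) * g t)"
      by (auto simp: norm_mult intro!: M.integrable_const_bound)
  qed simp
  have "(\<integral>x. fourier g (\<xi> - x) \<partial>M) = (CLBINT t. \<integral>x. iexp (-(t * (\<xi> - x))) * g t \<partial>M)"
    unfolding fourier_def by (rule Fubini_integral[OF int])
  also have "\<dots> = fourier (\<lambda>t. char M t * g t) \<xi>"
    unfolding fourier_def
  proof (intro Bochner_Integration.integral_cong refl)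
    fix t
    have "(\<integral>x. iexp (-(t * (\<xi> - x))) * g t \<partial>M) = (\<integral>x. iexp (-(t * \<xi>)) * g t * iexp (t * x) \<partial>M)"
      by (intro Bochner_Integration.integral_cong refl)
        (simp add: algebra_simps exp_diff exp_add exp_minus field_simps)
    then show "(\<integral>x. iexp (-(t * (\<xi> - x))) * g t \<partial>M) = iexp (-(t * \<xi>)) * (char M t * g t)"
      by (simp add: char_def)
  qed
  finally show ?thesis .
qed

text \<open>
  Each factor \<open>\<delta>\<^sub>0 - M\<close>, moved to the integrand, multiplies the function under the Fourier integral with
  its characteristic function \<open>1 - char M\<close>.
\<close>

lemma signed_integral_conv_power_fourier:
  assumes M: "real_distribution M" and g: "integrable lborel g"
  shows "signed_integral (conv_power (deconv_pi M) n) (\<lambda>x. Re (fourier g (\<xi> - x)))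
    = Re (fourier (\<lambda>t. (1 - char M t) ^ n * g t) \<xi>)"
  using g
proof (induction n arbitrary: g)
  interpret M: real_distribution M by fact
  have meas: "(\<lambda>x. Re (fourier g (\<xi> - x))) \<in> borel_measurable borel"
    and bdd: "bounded (range (\<lambda>x. Re (fourier g (\<xi> - x))))" if g: "integrable lborel g" for g
  proof -
    show "(\<lambda>x. Re (fourier g (\<xi> - x))) \<in> borel_measurable borel"
      using borel_measurable_fourier[OF g] by measurable
    show "bounded (range (\<lambda>x. Re (fourier g (\<xi> - x))))"
      using norm_fourier_le[of g] abs_Re_le_cmod
      by (auto simp: bounded_iff intro!: exI[of _ "LBINT t. norm (g t)"] intro: order_trans)
  qed
  {
    case 0
    then show ?case using signed_integral_dirac0[OF meas bdd] by simp
  next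
    case (Suc n)
    note g = Suc.prems
    have chg: "integrable lborel (\<lambda>t. char M t * g t)"
    proof (rule Bochner_Integration.integrable_bound[OF g])
      show "AE t in lborel. norm (char M t * g t) \<le> norm (g t)"
        using M.cmod_char_le_1 by (auto simp: norm_mult intro!: mult_left_le_one_le)
    qed (use g in measurable)
    have "(\<integral>x. Re (fourier g (\<xi> - (x + y))) \<partial>M) = Re (fourier (\<lambda>t. char M t * g t) (\<xi> - y))" for y
    proof -
      have fm: "(\<lambda>x. fourier g (\<xi> - y - x)) \<in> borel_measurable borel"
        using borel_measurable_fourier[OF g] by measurable
      have "integrable M (\<lambda>x. fourier g (\<xi> - y - x))"
        using norm_fourier_le[of g]
        by (intro finite_borel_measure_integrable M.finite_borel_measure_M fm) (auto simp: bounded_iff)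
      then have "(\<integral>x. Re (fourier g (\<xi> - y - x)) \<partial>M) = Re (\<integral>x. fourier g (\<xi> - y - x) \<partial>M)"
        by (rule integral_Re)
      moreover have "\<xi> - (x + y) = \<xi> - y - x" for x by simp
      ultimately show ?thesis
        by (simp only: integral_fourier_translate[OF M g])
    qed
    then have "signed_integral (conv_power (deconv_pi M) (Suc n)) (\<lambda>x. Re (fourier g (\<xi> - x))) =
        signed_integral (conv_power (deconv_pi M) n)
          (\<lambda>y. Re (fourier g (\<xi> - y)) - Re (fourier (\<lambda>t. char M t * g t) (\<xi> - y)))"
      by (subst signed_integral_conv_power_Suc[OF M meas[OF g] bdd[OF g]]) simp
    also have "\<dots> = signed_integral (conv_power (deconv_pi M) n)
          (\<lambda>y. Re (fourier (\<lambda>t. g t - char M t * g t) (\<xi> - y)))"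
      by (simp add: fourier_diff[OF g chg])
    also have "\<dots> = Re (fourier (\<lambda>t. (1 - char M t) ^ n * (g t - char M t * g t)) \<xi>)"
      using g chg by (intro Suc.IH) simp
    finally show ?case by (simp add: algebra_simps)
  }
qed


section \<open>Limits of supremum norms\<close>

lemma sup_norm_minus: "sup_norm (\<lambda>x. - f x) = sup_norm f"
  by (simp add: sup_norm_def)

lemma sup_norm_le_add:
  assumes "\<And>x. \<bar>f x - g x\<bar> \<le> e"
  shows "sup_norm f \<le> sup_norm g + ennreal e"
  unfolding sup_norm_def
proof (rule SUP_least)
  fix x
  have "ennreal \<bar>f x\<bar> \<le> ennreal (\<bar>g x\<bar> + e)"
    using assms[of x] by (intro ennreal_leI) linarith
  also have "\<dots> = ennreal \<bar>g x\<bar> + ennreal e"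
    using assms[of x] by (intro ennreal_plus) auto
  also have "\<dots> \<le> (SUP x. ennreal \<bar>g x\<bar>) + ennreal e"
    by (intro add_right_mono SUP_upper) simp
  finally show "ennreal \<bar>f x\<bar> \<le> (SUP x. ennreal \<bar>g x\<bar>) + ennreal e" .
qed

lemma sup_norm_tendsto:
  assumes fin: "sup_norm g < top"
    and e: "\<And>m x. \<bar>f m x - g x\<bar> \<le> e m" "e \<longlonglongrightarrow> 0"
  shows "(\<lambda>m. sup_norm (f m)) \<longlonglongrightarrow> sup_norm g"
proof -
  have e0: "0 \<le> e m" for m using e(1)[of m undefined] by linarith
  have le: "sup_norm (f m) \<le> sup_norm g + ennreal (e m)" "sup_norm g \<le> sup_norm (f m) + ennreal (e m)" for m
    using e(1)[of m] by (auto intro!: sup_norm_le_add simp: abs_minus_commute)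
  have fin': "sup_norm (f m) < top" for m
    using le(1)[of m] fin by (metis ennreal_add_less_top ennreal_less_top le_less_trans)
  obtain L where L: "sup_norm g = ennreal L" "0 \<le> L"
    using fin by (cases "sup_norm g") auto
  define a where "a = (\<lambda>m. enn2real (sup_norm (f m)))"
  have a: "sup_norm (f m) = ennreal (a m)" "0 \<le> a m" for m
    using fin'[of m] by (auto simp: a_def)
  have "\<bar>a m - L\<bar> \<le> e m" for m
    using le[of m] L(2) a(2)[of m] e0[of m]
    by (simp add: L a(1) abs_le_iff ennreal_le_iff flip: ennreal_plus)
  then have "(\<lambda>m. a m - L) \<longlonglongrightarrow> 0"
    by (intro Lim_null_comparison[OF _ e(2)]) simp
  then have "a \<longlonglongrightarrow> L"
    by (simp add: LIM_zero_iff)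
  then show ?thesis unfolding a(1) L(1) by (rule tendsto_ennrealI)
qed

section \<open>The deconvolution error as a Fourier integral\<close>

text \<open>
  Where \<open>0 < t < \<tau>\<close> the factor \<open>char chi t\<close> is bounded by 1, where \<open>t > T\<close> the factor \<open>1 - char M t\<close> is,
  and in between both are and \<open>1 / t \<le> 1 / \<tau>\<close>.  The modulus is even in \<open>t\<close>, so the bound on the
  positive half-line carries over to the negative one.
\<close>

lemma integrable_char_quotient:
  assumes chi: "real_distribution chi" and M: "real_distribution M"
    and real: "\<And>t. char M t \<in> \<real>" "\<And>t. Re (char M t) \<in> {0..1}" and even: "\<And>t. char M (-t) = char M t"
    and near0: "\<tau> > 0" "(\<integral>\<^sup>+t\<in>{0<..<\<tau>}. ennreal ((1 - Re (char M t)) / t) \<partial>lborel) < \<infinity>"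
    and far: "T > 0" "(\<integral>\<^sup>+t\<in>{T<..}. ennreal (cmod (char chi t) / t) \<partial>lborel) < \<infinity>"
  shows "integrable lborel (\<lambda>t. char chi t * (1 - char M t) / t)"
proof -
  interpret chi: real_distribution chi by fact
  interpret M: real_distribution M by fact
  define u1 u2 u3 :: "real \<Rightarrow> ennreal"
    where "u1 t = ennreal ((1 - Re (char M t)) / t) * indicator {0<..<\<tau>} t"
      and "u2 t = ennreal (1 / \<tau>) * indicator {\<tau>..T} t"
      and "u3 t = ennreal (cmod (char chi t) / t) * indicator {T<..} t" for t
  define u where "u t = u1 t + (u2 t + u3 t)" for t
  note u_defs = u_def u1_def u2_def u3_def
  have [measurable]: "u1 \<in> borel_measurable borel" "u2 \<in> borel_measurable borel" "u3 \<in> borel_measurable borel"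
    unfolding u1_def u2_def u3_def by measurable
  have [measurable]: "u \<in> borel_measurable borel" unfolding u_def by measurable
  have "integral\<^sup>N lborel u2 = ennreal (1 / \<tau>) * emeasure lborel {\<tau>..T}"
    unfolding u2_def by (rule nn_integral_cmult_indicator) simp
  then have "integral\<^sup>N lborel u2 < \<infinity>"
    by (cases "\<tau> \<le> T") (auto simp: ennreal_mult_less_top)
  moreover have "integral\<^sup>N lborel u1 < \<infinity>" "integral\<^sup>N lborel u3 < \<infinity>"
    unfolding u1_def u3_def using near0 far by auto
  ultimately have "integral\<^sup>N lborel u < \<infinity>"
    unfolding u_def by (simp add: nn_integral_add)
  moreover have "(\<integral>\<^sup>+t. u (-t) \<partial>lborel) = integral\<^sup>N lborel u"
    using nn_integral_real_affine[of u "-1" 0] by simp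
  ultimately have fin: "(\<integral>\<^sup>+t. u t + u (-t) \<partial>lborel) < \<infinity>"
    by (simp add: nn_integral_add)
  have re: "cmod (1 - char M t) = 1 - Re (char M t)" for t
  proof -
    have "1 - char M t = complex_of_real (1 - Re (char M t))"
      using real(1)[of t] by (auto elim!: Reals_cases)
    then show ?thesis using real(2)[of t] by (metis abs_of_nonneg atLeastAtMost_iff diff_ge_0_iff_ge norm_of_real)
  qed
  \<comment> \<open>The summands of \<open>u\<close> cover the positive half-line, whichever of \<open>\<tau>\<close> and \<open>T\<close> is larger.\<close>
  have pos: "ennreal (cmod (char chi s) * (1 - Re (char M s)) / s) \<le> u s" if "s > 0" for s
  proof -
    have c: "cmod (char chi s) \<le> 1" "0 \<le> 1 - Re (char M s)" "1 - Re (char M s) \<le> 1"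
      using chi.cmod_char_le_1 real(2)[of s] by auto
    have c1: "cmod (char chi s) * (1 - Re (char M s)) \<le> 1 - Re (char M s)"
      "cmod (char chi s) * (1 - Re (char M s)) \<le> cmod (char chi s)"
      using c by (auto intro: mult_left_le_one_le mult_right_le_one_le)
    consider "s < \<tau>" | "\<tau> \<le> s" "s \<le> T" | "\<tau> \<le> s" "T < s" by linarith
    then show ?thesis
    proof cases
      case 1
      have "ennreal (cmod (char chi s) * (1 - Re (char M s)) / s) \<le> ennreal ((1 - Re (char M s)) / s)"
        using c1 that by (intro ennreal_leI divide_right_mono) auto
      also have "\<dots> \<le> u s" using 1 that by (simp add: u_defs)
      finally show ?thesis .
    next
      case 2
      have "ennreal (cmod (char chi s) * (1 - Re (char M s)) / s) \<le> ennreal (1 / \<tau>)"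
        using c1 c near0(1) that 2 by (intro ennreal_leI frac_le) auto
      also have "\<dots> \<le> u s" using 2 by (simp add: u_defs)
      finally show ?thesis .
    next
      case 3
      have "ennreal (cmod (char chi s) * (1 - Re (char M s)) / s) \<le> ennreal (cmod (char chi s) / s)"
        using c1 that by (intro ennreal_leI divide_right_mono) auto
      also have "\<dots> \<le> u s" using 3 by (simp add: u_defs)
      finally show ?thesis .
    qed
  qed
  have chi_even: "cmod (char chi (-t)) = cmod (char chi t)" for t
  proof -
    have "cnj (char chi t) = (\<integral>x. cnj (iexp (t * x)) \<partial>chi)"
      unfolding char_def by (rule Bochner_Integration.integral_cnj[symmetric])
    also have "\<dots> = char chi (-t)"
      unfolding char_def by (intro Bochner_Integration.integral_cong refl) (simp add: exp_cnj)
    finally have "char chi (-t) = cnj (char chi t)" by simp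
    then show ?thesis by simp
  qed
  have "ennreal (norm (char chi t * (1 - char M t) / t)) \<le> u t + u (-t)" for t
  proof -
    have n: "norm (char chi t * (1 - char M t) / t) = cmod (char chi t) * (1 - Re (char M t)) / \<bar>t\<bar>"
      by (simp add: norm_mult norm_divide re)
    consider "t = 0" | "t > 0" | "t < 0" by linarith
    then show ?thesis
    proof cases
      case 2
      then show ?thesis using pos[of t] unfolding n by (auto intro: add_increasing2)
    next
      case 3
      then show ?thesis using pos[of "-t"] unfolding n by (auto simp: even chi_even intro: add_increasing)
    qed simp
  qed
  then have "(\<integral>\<^sup>+t. ennreal (norm (char chi t * (1 - char M t) / t)) \<partial>lborel) \<le> (\<integral>\<^sup>+t. u t + u (-t) \<partial>lborel)"
    by (intro nn_integral_mono) auto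
  with fin show ?thesis
    by (intro integrableI_bounded) (auto intro: le_less_trans)
qed

text \<open>
  The remaining integrand \<open>cdf chi - cdf (chi \<star> M)\<close> of the telescoped sum is the Fourier integral given
  by the inversion formula, on which the convolution power acts as a multiplier.
\<close>

lemma deconv_fun_error_fourier:
  assumes chi: "real_distribution chi" and M: "real_distribution M"
    and int: "integrable lborel (\<lambda>t. char chi t * (1 - char M t) / t)"
  shows "deconv_fun chi M \<xi> m - cdf chi \<xi> =
    - Re (fourier (\<lambda>t. (1 - char M t) ^ m * (\<i> / (2 * pi) * (char chi t * (1 - char M t) / t))) \<xi>)"
proof -
  let ?g = "\<lambda>t. \<i> / (2 * pi) * (char chi t * (1 - char M t) / t)"
  have eq: "(char chi t - char (chi \<star> M) t) = char chi t * (1 - char M t)" for t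
    by (simp add: char_convolution[OF chi M] algebra_simps)
  have "complex_of_real (cdf chi x - cdf (chi \<star> M) x) = fourier ?g x" for x
    using cdf_diff_eq_fourier[OF chi real_distribution_convolution[OF chi M], of x] int
    unfolding eq .
  then have "cdf chi x - cdf (chi \<star> M) x = Re (fourier ?g x)" for x
    by (metis Re_complex_of_real)
  then show ?thesis
    by (simp only: deconv_fun_eq[OF chi M]
        signed_integral_conv_power_fourier[OF M integrable_mult_right[OF int]])
qed

theorem theorem6p1:
  fixes chi \<mu> \<mu>' :: "real measure"
  assumes "real_distribution chi" and "real_distribution \<mu>"
    and "symmetrization \<mu> \<mu>'"
    and "\<exists>\<tau>>0. (\<integral>\<^sup>+t\<in>{0<..<\<tau>}. ennreal ((1 - Re (char \<mu>' t)) / t) \<partial>lborel) < \<infinity>"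
    and "\<exists>T>0. (\<integral>\<^sup>+t\<in>{T<..}. ennreal (cmod (char chi t) / t) \<partial>lborel) < \<infinity>"
  shows "\<exists>L::real. 0 \<le> L \<and>
      (\<lambda>m. sup_norm (\<lambda>\<xi>. deconv_fun chi \<mu>' \<xi> m - cdf chi \<xi>)) \<longlonglongrightarrow> ennreal L \<and>
      ({t::real. ereal t \<in> char_zeros \<mu> - char_zeros chi} \<in> null_sets lborel \<longrightarrow> L = 0)"
proof -
  note chi = assms(1)
  have M: "real_distribution \<mu>'" and even: "char \<mu>' (-t) = char \<mu>' t"
    and real: "char \<mu>' t \<in> \<real>" "Re (char \<mu>' t) \<in> {0..1}"
    and zeros: "char_zeros \<mu>' = char_zeros \<mu>" for t
    using assms(3) by (auto simp: symmetrization_def)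
  interpret chi: real_distribution chi by fact
  interpret M: real_distribution \<mu>' by fact
  have int: "integrable lborel (\<lambda>t. char chi t * (1 - char \<mu>' t) / t)"
    using assms(4,5) integrable_char_quotient[OF chi M real even] by blast
  define g where "g = (\<lambda>t. \<i> / (2 * pi) * (char chi t * (1 - char \<mu>' t) / t))"
  have g: "integrable lborel g"
    unfolding g_def using int by (rule integrable_mult_right)
  have [measurable]: "g \<in> borel_measurable borel" using g by auto
  define p where "p = (\<lambda>m t. (1 - char \<mu>' t) ^ m)"
  define q where "q = (\<lambda>t. if char \<mu>' t = 0 then 1 else 0 :: complex)"
  have p_eq: "1 - char \<mu>' t = complex_of_real (1 - Re (char \<mu>' t))" for t
    using real(1)[of t] by (auto elim!: Reals_cases)
  have p_le: "norm (p m t) \<le> 1" and q_le: "norm (q t) \<le> 1" for m t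
    unfolding p_def q_def p_eq norm_power norm_of_real using real(2)[of t] by (auto intro: power_le_one)
  \<comment> \<open>A zero of the characteristic function keeps the base of the power equal to 1; elsewhere the base lies in \<open>[0, 1)\<close>.\<close>
  have p_lim: "(\<lambda>m. p m t) \<longlonglongrightarrow> q t" for t
  proof (cases "char \<mu>' t = 0")
    case False
    then have "Re (char \<mu>' t) \<noteq> 0" using p_eq[of t] by auto
    then have "norm (1 - char \<mu>' t) < 1"
      unfolding p_eq norm_of_real using real(2)[of t] by auto
    with False show ?thesis by (simp add: p_def q_def LIMSEQ_power_zero)
  qed (simp add: p_def q_def)
  have [measurable]: "p m \<in> borel_measurable borel" "q \<in> borel_measurable borel" for m
    unfolding p_def q_def by measurable
  have pg: "integrable lborel (\<lambda>t. p m t * g t)" for m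
    using p_le by (intro Bochner_Integration.integrable_bound[OF g]) (auto simp: norm_mult intro!: mult_left_le_one_le)
  have qg: "integrable lborel (\<lambda>t. q t * g t)"
    using q_le by (intro Bochner_Integration.integrable_bound[OF g]) (auto simp: norm_mult intro!: mult_left_le_one_le)
  define G where "G = (\<lambda>\<xi>. Re (fourier (\<lambda>t. q t * g t) \<xi>))"
  define e where "e = (\<lambda>m. LBINT t. norm (p m t * g t - q t * g t))"
  have G_le: "\<bar>G \<xi>\<bar> \<le> (LBINT t. norm (q t * g t))" for \<xi>
    unfolding G_def by (rule order_trans[OF abs_Re_le_cmod norm_fourier_le])
  have dist: "\<bar>Re (fourier (\<lambda>t. p m t * g t) \<xi>) - G \<xi>\<bar> \<le> e m" for m \<xi>
    unfolding G_def e_def minus_complex.simps[symmetric] fourier_diff[OF pg qg, symmetric]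
    by (rule order_trans[OF abs_Re_le_cmod norm_fourier_le])
  have "e \<longlonglongrightarrow> (LBINT t::real. 0)"
    unfolding e_def
  proof (rule integral_dominated_convergence[where w="\<lambda>t. 2 * norm (g t)"])
    have "(\<lambda>m. norm (p m t * g t - q t * g t)) \<longlonglongrightarrow> norm (q t * g t - q t * g t)" for t
      by (intro tendsto_intros p_lim)
    then show "AE t in lborel. (\<lambda>m. norm (p m t * g t - q t * g t)) \<longlonglongrightarrow> 0"
      by simp
    have "norm (p m t * g t - q t * g t) \<le> 2 * norm (g t)" for m t
    proof -
      have "norm (p m t - q t) \<le> 1 + 1"
        using norm_triangle_ineq4[of "p m t" "q t"] p_le[of m t] q_le[of t] by linarith
      then show ?thesis
        by (simp add: left_diff_distrib[symmetric] norm_mult mult_right_mono)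
    qed
    then show "AE t in lborel. norm (norm (p m t * g t - q t * g t)) \<le> 2 * norm (g t)" for m
      by simp
  qed (use g in auto)
  then have e: "e \<longlonglongrightarrow> 0" by simp
  have fin: "sup_norm G < top"
  proof -
    have "sup_norm G \<le> ennreal (LBINT t. norm (q t * g t))"
      unfolding sup_norm_def by (intro SUP_least ennreal_leI G_le)
    then show ?thesis using ennreal_less_top le_less_trans by blast
  qed
  have "sup_norm (\<lambda>\<xi>. deconv_fun chi \<mu>' \<xi> m - cdf chi \<xi>) = sup_norm (\<lambda>\<xi>. Re (fourier (\<lambda>t. p m t * g t) \<xi>))" for m
    unfolding deconv_fun_error_fourier[OF chi M int] p_def g_def by (rule sup_norm_minus)
  then have lim: "(\<lambda>m. sup_norm (\<lambda>\<xi>. deconv_fun chi \<mu>' \<xi> m - cdf chi \<xi>)) \<longlonglongrightarrow> sup_norm G"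
    using sup_norm_tendsto[OF fin dist e] by simp
  \<comment> \<open>The limit integrand vanishes off the zeros for \<open>\<mu>\<close> because of \<open>q\<close>, and at the zeros for \<open>chi\<close> because of \<open>g\<close>.\<close>
  have zero: "sup_norm G = 0" if "{t::real. ereal t \<in> char_zeros \<mu> - char_zeros chi} \<in> null_sets lborel"
  proof -
    have "ereal t \<in> char_zeros N \<longleftrightarrow> char N t = 0" for t N
      by (auto simp: char_zeros_def)
    then have "AE t in lborel. q t * g t = 0"
      by (intro AE_I'[OF that]) (auto simp: q_def g_def zeros[symmetric])
    then have "(LBINT t. norm (q t * g t)) = 0"
      by (intro integral_eq_zero_AE) auto
    then have "G \<xi> = 0" for \<xi> using G_le[of \<xi>] by simp
    then show ?thesis by (simp add: sup_norm_def)
  qed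
  show ?thesis
  proof (intro exI conjI impI)
    show "(\<lambda>m. sup_norm (\<lambda>\<xi>. deconv_fun chi \<mu>' \<xi> m - cdf chi \<xi>)) \<longlonglongrightarrow> ennreal (enn2real (sup_norm G))"
      using lim fin by simp
  qed (simp_all add: zero)
qed

end
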